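(* Let $q\ge 2$ be a prime power, $r_1,r_2\ge 1$, and let $\tau_1$ and $\tau_2$ be permutations of $F_q^{r_1}$ and $F_q^{r_2}$ with distensions $l_1$ and $l_2$ respectively, such that $\tau_1({\bf 0})={\bf 0}$ and $\tau_2({\bf 0})={\bf 0}$. Then the distension of the permutation $\tau_1|\tau_2$ of $F_q^{r_1+r_2}$ is $l_1+l_2$.
   Context: For $r\ge 1$ let $D^{(r)}$ be the linear code of length $q^r$ over $F_q$ with coordinate positions indexed by vectors of $F_q^r$, $D^{(r)}=\{y=(y_c)_{c\in F_q^r}: \sum_c y_c=0,\ \sum_c y_c c={\bf 0}\}$. A permutation $\tau$ of $F_q^r$ acts on vectors of length $q^r$ by permuting positions ($e_c\mapsto e_{\tau(c)}$, where $e_c$ is the unit vector at position $c$, extended linearly). The distension of $\tau$ is $\dim D^{(r)}-\dim(D^{(r)}\cap\tau(D^{(r)}))$. For permutations $\tau_1$ of $F_q^{r_1}$ and $\tau_2$ of $F_q^{r_2}$, $\tau_1|\tau_2$ is the permutation of $F_q^{r_1+r_2}$ defined by $(\tau_1|\tau_2)\binom{a}{b}=\binom{\tau_1(a)}{\tau_2(b)}$ for $a\in F_q^{r_1}$, $b\in F_q^{r_2}$. *)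

theory Defs
  imports "HOL-Analysis.Cartesian_Space"
begin

text \<open>
  \<open>F\<^sub>q\<close> is a type \<open>'q\<close> of class \<open>{field, finite}\<close> and \<open>F\<^sub>q\<^sup>r\<close> is \<open>'q ^ 'r\<close> with \<open>r = CARD('r)\<close>.
  Words of length \<open>q\<^sup>r\<close> with positions indexed by \<open>F\<^sub>q\<^sup>r\<close> have type \<open>'q ^ ('q ^ 'r)\<close>.
\<close>

definition D_code :: "('q::{field,finite} ^ ('q ^ 'r::finite)) set" where
  "D_code = {y. (\<Sum>c\<in>UNIV. y $ c) = 0 \<and> (\<Sum>c\<in>UNIV. y $ c *s c) = 0}"

text \<open>The linear map sending the unit vector at position \<open>c\<close> to the one at position \<open>\<tau> c\<close>.\<close>

definition permute_positions ::
    "('q ^ 'r \<Rightarrow> 'q ^ 'r) \<Rightarrow> 'q::{field,finite} ^ ('q ^ 'r::finite) \<Rightarrow> 'q ^ ('q ^ 'r)" where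
  "permute_positions \<tau> y = (\<Sum>c\<in>UNIV. y $ c *s axis (\<tau> c) 1)"

text \<open>
  Truncation of the subtraction on \<^typ>\<open>nat\<close> is harmless, the subtrahend being the dimension of a
  subspace of the code.
\<close>

definition distension :: "('q::{field,finite} ^ 'r::finite \<Rightarrow> 'q ^ 'r) \<Rightarrow> nat" where
  "distension \<tau> = vec.dim (D_code :: ('q ^ ('q ^ 'r)) set)
     - vec.dim ((D_code :: ('q ^ ('q ^ 'r)) set) \<inter> permute_positions \<tau> ` D_code)"

text \<open>
  \<open>F\<^sub>q\<close>-vectors with \<open>r\<^sub>1 + r\<^sub>2\<close> coordinates are indexed by the sum type \<open>'r1 + 'r2\<close>;
  \<open>stack a b\<close> is the column with \<open>a\<close> above \<open>b\<close>.
\<close>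

definition stack :: "'a ^ 'r1::finite \<Rightarrow> 'a ^ 'r2::finite \<Rightarrow> 'a ^ ('r1 + 'r2)" where
  "stack a b = (\<chi> k. case k of Inl i \<Rightarrow> a $ i | Inr j \<Rightarrow> b $ j)"

definition upper :: "'a ^ ('r1::finite + 'r2::finite) \<Rightarrow> 'a ^ 'r1" where
  "upper v = (\<chi> i. v $ Inl i)"

definition lower :: "'a ^ ('r1::finite + 'r2::finite) \<Rightarrow> 'a ^ 'r2" where
  "lower v = (\<chi> j. v $ Inr j)"

definition join_perm ::
    "('a ^ 'r1::finite \<Rightarrow> 'a ^ 'r1) \<Rightarrow> ('a ^ 'r2::finite \<Rightarrow> 'a ^ 'r2)
      \<Rightarrow> 'a ^ ('r1 + 'r2) \<Rightarrow> 'a ^ ('r1 + 'r2)" where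
  "join_perm \<tau>1 \<tau>2 v = stack (\<tau>1 (upper v)) (\<tau>2 (lower v))"

lemma upper_stack [simp]: "upper (stack a b) = a"
  by (simp add: upper_def stack_def vec_eq_iff)

lemma lower_stack [simp]: "lower (stack a b) = b"
  by (simp add: lower_def stack_def vec_eq_iff)

lemma stack_upper_lower [simp]: "stack (upper v) (lower v) = v"
  by (simp add: upper_def lower_def stack_def vec_eq_iff split: sum.split)

lemma join_perm_stack: "join_perm \<tau>1 \<tau>2 (stack a b) = stack (\<tau>1 a) (\<tau>2 b)"
  by (simp add: join_perm_def)

lemma permute_positions_axis: "permute_positions \<tau> (axis c 1) = axis (\<tau> c) 1"
proof -
  have "permute_positions \<tau> (axis c 1) = (\<Sum>d\<in>UNIV. if d = c then axis (\<tau> d) 1 else 0)"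
    unfolding permute_positions_def
    by (rule sum.cong) (auto simp: axis_def vec_eq_iff)
  then show ?thesis
    by simp
qed

lemma bij_join_perm:
  assumes "bij \<tau>1" and "bij \<tau>2"
  shows "bij (join_perm \<tau>1 \<tau>2)"
proof (rule o_bij)
  show "join_perm (inv \<tau>1) (inv \<tau>2) \<circ> join_perm \<tau>1 \<tau>2 = id"
    using assms by (auto simp: fun_eq_iff join_perm_def bij_is_inj)
  show "join_perm \<tau>1 \<tau>2 \<circ> join_perm (inv \<tau>1) (inv \<tau>2) = id"
    using assms by (auto simp: fun_eq_iff join_perm_def bij_is_surj surj_f_inv_f)
qed

end

theory Submission
  imports Defs
begin

text \<open>
  For a permutation \<open>\<tau>\<close> the code \<open>D \<inter> \<tau>(D)\<close> is the kernel of the linear map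
  \<open>y \<mapsto> \<Sum>\<^sub>c y\<^sub>c \<tau>\<^sup>-\<^sup>1(c)\<close> on \<open>D\<close>, so by rank-nullity the distension of \<open>\<tau>\<close> is the dimension of the
  image of \<open>D\<close> under this map. For \<open>\<tau>\<^sub>1|\<tau>\<^sub>2\<close> that image is the direct product of the images for
  \<open>\<tau>\<^sub>1\<close> and \<open>\<tau>\<^sub>2\<close>: summing a codeword over one block of coordinates gives a codeword
  for the other block, and conversely a codeword for one block can be placed on the positions
  whose other block is \<open>0\<close>, where it contributes nothing to the other component because
  its entries sum to zero.
\<close>

section \<open>Rank-nullity on a subspace and the dimension of a product\<close>

lemma linear_vecI:
  fixes f :: "'q::field ^ 'm::finite \<Rightarrow> 'q ^ 'n::finite"
  assumes "\<And>x y. f (x + y) = f x + f y" and "\<And>k x. f (k *s x) = k *s f x"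
  shows "Vector_Spaces.linear (*s) (*s) f"
  using assms by (simp add: Vector_Spaces.linear_iff vec.vector_space_axioms)

text \<open>A linear right inverse \<open>g\<close> of \<open>f\<close> on the image of
  \<open>S\<close>, with values in \<open>S\<close>, embeds that image as a complement of the kernel
  inside \<open>S\<close>. The dimension formula for a sum of subspaces then gives the
  claim.\<close>

lemma dim_kernel_plus_dim_image:
  fixes f :: "'q::field ^ 'm::finite \<Rightarrow> 'q ^ 'n::finite"
  assumes f: "Vector_Spaces.linear (*s) (*s) f" and S: "vec.subspace S"
  shows "vec.dim (S \<inter> {x. f x = 0}) + vec.dim (f ` S) = vec.dim S"
proof -
  interpret f: Vector_Spaces.linear "(*s)" "(*s)" f
    by (rule f)
  obtain g where gS: "range g \<subseteq> S" and g: "Vector_Spaces.linear (*s) (*s) g"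
    and fg: "\<And>v. v \<in> f ` S \<Longrightarrow> f (g v) = v"
    using vec.linear_exists_right_inverse_on[OF f S] by blast
  interpret g: Vector_Spaces.linear "(*s)" "(*s)" g
    by (rule g)
  let ?K = "S \<inter> {x. f x = 0}" and ?W = "g ` f ` S"
  have fS: "vec.subspace (f ` S)"
    using S by (rule f.subspace_image)
  have K: "vec.subspace ?K"
    using S by (auto simp: vec.subspace_def f.add f.scale)
  have W: "vec.subspace ?W"
    using fS by (rule g.subspace_image)
  have "inj_on g (vec.span (f ` S))"
    unfolding vec.span_eq_iff[THEN iffD2, OF fS] by (metis fg inj_onI)
  then have dimW: "vec.dim ?W = vec.dim (f ` S)"
    using g by (intro vec.dim_image_eq)
  have "?K \<inter> ?W \<subseteq> {0}"
  proof
    fix x assume "x \<in> ?K \<inter> ?W"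
    then obtain v where "v \<in> f ` S" "x = g v" "f x = 0"
      by blast
    then show "x \<in> {0}"
      using fg g.zero by auto
  qed
  then have "?K \<inter> ?W = {0}"
    using K W by (auto dest: vec.subspace_0)
  moreover have "{x + y |x y. x \<in> ?K \<and> y \<in> ?W} = S"
  proof (intro equalityI subsetI)
    fix z assume "z \<in> {x + y |x y. x \<in> ?K \<and> y \<in> ?W}"
    then show "z \<in> S"
      using gS S by (auto intro!: vec.subspace_add)
  next
    fix z assume z: "z \<in> S"
    \<comment> \<open>Since \<open>f (g (f z)) = f z\<close>, subtracting \<open>g (f z)\<close>
      projects \<open>z\<close> onto the kernel.\<close>
    have "z - g (f z) \<in> ?K"
      using z gS S fg by (auto intro!: vec.subspace_diff simp: f.diff)
    then show "z \<in> {x + y |x y. x \<in> ?K \<and> y \<in> ?W}"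
      using z by (intro CollectI exI[of _ "z - g (f z)"] exI[of _ "g (f z)"]) simp
  qed
  ultimately show ?thesis
    using vec.dim_sums_Int[OF K W] dimW by simp
qed

text \<open>Padding with zeros embeds \<open>S\<close> and \<open>T\<close> injectively as subspaces
  that meet only in 0 and whose sum is the product.\<close>

lemma dim_stack_product:
  fixes S :: "('q::field ^ 'm::finite) set" and T :: "('q ^ 'n::finite) set"
  assumes S: "vec.subspace S" and T: "vec.subspace T"
  shows "vec.dim {stack a b |a b. a \<in> S \<and> b \<in> T} = vec.dim S + vec.dim T"
proof -
  define i where "i = (\<lambda>a. stack a 0 :: 'q ^ ('m + 'n))"
  define j where "j = (\<lambda>b. stack 0 b :: 'q ^ ('m + 'n))"
  have li: "Vector_Spaces.linear (*s) (*s) i"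
    by (rule linear_vecI) (auto simp: i_def stack_def vec_eq_iff split: sum.split)
  have lj: "Vector_Spaces.linear (*s) (*s) j"
    by (rule linear_vecI) (auto simp: j_def stack_def vec_eq_iff split: sum.split)
  interpret i: Vector_Spaces.linear "(*s)" "(*s)" i by (rule li)
  interpret j: Vector_Spaces.linear "(*s)" "(*s)" j by (rule lj)
  have "inj i"
    by (rule inj_on_inverseI[of _ upper]) (simp add: i_def)
  then have di: "vec.dim (i ` S) = vec.dim S"
    by (rule vec.dim_image_eq[OF li inj_on_subset[OF _ subset_UNIV]])
  have "inj j"
    by (rule inj_on_inverseI[of _ lower]) (simp add: j_def)
  then have dj: "vec.dim (j ` T) = vec.dim T"
    by (rule vec.dim_image_eq[OF lj inj_on_subset[OF _ subset_UNIV]])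
  have "i ` S \<inter> j ` T \<subseteq> {0}"
  proof
    fix x assume "x \<in> i ` S \<inter> j ` T"
    then obtain a b where "x = i a" "x = j b"
      by blast
    then have "a = 0"
      unfolding i_def j_def by (metis upper_stack)
    then show "x \<in> {0}"
      using \<open>x = i a\<close> i.zero by simp
  qed
  then have "i ` S \<inter> j ` T = {0}"
    using i.subspace_image[OF S] j.subspace_image[OF T] by (auto dest: vec.subspace_0)
  moreover have "stack a b = i a + j b" for a b
    by (simp add: i_def j_def stack_def vec_eq_iff split: sum.split)
  then have "{stack a b |a b. a \<in> S \<and> b \<in> T} = {x + y |x y. x \<in> i ` S \<and> y \<in> j ` T}"
    by auto
  ultimately show ?thesis
    using vec.dim_sums_Int[OF i.subspace_image[OF S] j.subspace_image[OF T]] di dj by simp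
qed

lemma sum_UNIV_stack:
  fixes g :: "'q::finite ^ ('m::finite + 'n::finite) \<Rightarrow> 'b::comm_monoid_add"
  shows "(\<Sum>v\<in>UNIV. g v) = (\<Sum>a\<in>UNIV. \<Sum>b\<in>UNIV. g (stack a b))"
proof -
  have "(\<Sum>v\<in>UNIV. g v) = (\<Sum>p\<in>UNIV \<times> UNIV. g (stack (fst p) (snd p)))"
    by (rule sum.reindex_bij_witness[where i = "\<lambda>p. stack (fst p) (snd p)"
          and j = "\<lambda>v. (upper v, lower v)"]) auto
  then show ?thesis
    by (simp add: sum.cartesian_product case_prod_beta)
qed

section \<open>The distension as the dimension of an image\<close>

definition weighted_sum ::
    "('i::finite \<Rightarrow> 'q::field ^ 's::finite) \<Rightarrow> 'q ^ 'i \<Rightarrow> 'q ^ 's" where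
  "weighted_sum \<sigma> y = (\<Sum>c\<in>UNIV. y $ c *s \<sigma> c)"

lemma linear_weighted_sum: "Vector_Spaces.linear (*s) (*s) (weighted_sum \<sigma>)"
  by (rule linear_vecI)
    (simp_all add: weighted_sum_def vec.scale_left_distrib sum.distrib vec.scale_sum_right)

text \<open>Puts the second check in a form where the code and its permuted copy differ only in the
  argument of \<open>weighted_sum\<close>.\<close>

lemma D_code_eq: "D_code = {y. (\<Sum>c\<in>UNIV. y $ c) = 0 \<and> weighted_sum (\<lambda>c. c) y = 0}"
  by (simp add: D_code_def weighted_sum_def)

lemma subspace_D_code: "vec.subspace D_code"
proof -
  interpret w: Vector_Spaces.linear "(*s)" "(*s)" "weighted_sum (\<lambda>c :: 'a ^ 'b. c)"
    by (rule linear_weighted_sum)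
  show ?thesis
    by (auto simp: vec.subspace_def D_code_eq w.zero w.add w.scale sum.distrib
        simp flip: sum_distrib_left)
qed

lemma subspace_weighted_sum_image: "vec.subspace (weighted_sum \<sigma> ` D_code)"
proof -
  interpret w: Vector_Spaces.linear "(*s)" "(*s)" "weighted_sum \<sigma>"
    by (rule linear_weighted_sum)
  show ?thesis
    by (rule w.subspace_image[OF subspace_D_code])
qed

lemma permute_positions_nth:
  assumes "bij \<tau>"
  shows "permute_positions \<tau> y $ d = y $ inv \<tau> d"
proof -
  have "permute_positions \<tau> y $ d = (\<Sum>c\<in>UNIV. if c = inv \<tau> d then y $ c else 0)"
    unfolding permute_positions_def sum_component
    by (rule sum.cong)
      (use assms in \<open>auto simp: axis_def bij_inv_eq_iff bij_is_inj bij_is_surj surj_f_inv_f\<close>)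
  then show ?thesis
    by simp
qed

text \<open>Reindexing by \<open>inv \<tau>\<close> leaves the total of the entries unchanged and
  turns the check with weights \<open>c\<close> into the one with weights
  \<open>inv \<tau> c\<close>.\<close>

lemma permute_positions_image_D_code:
  fixes \<tau> :: "'q::{field,finite} ^ 'r::finite \<Rightarrow> 'q ^ 'r"
  assumes "bij \<tau>"
  shows "permute_positions \<tau> ` D_code
    = {y. (\<Sum>c\<in>UNIV. y $ c) = 0 \<and> weighted_sum (inv \<tau>) y = 0}"
proof -
  have sum1: "(\<Sum>c\<in>UNIV. permute_positions \<tau> y $ c) = (\<Sum>c\<in>UNIV. y $ c)"
    for y :: "'q ^ ('q ^ 'r)"
    unfolding permute_positions_nth[OF assms]
    using sum.reindex_bij_betw[of "inv \<tau>" UNIV UNIV "\<lambda>c. y $ c"] bij_imp_bij_inv[OF assms]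
    by simp
  have sum2: "weighted_sum (inv \<tau>) (permute_positions \<tau> y) = weighted_sum (\<lambda>c. c) y"
    for y :: "'q ^ ('q ^ 'r)"
    unfolding weighted_sum_def permute_positions_nth[OF assms]
    using sum.reindex_bij_betw[of "inv \<tau>" UNIV UNIV "\<lambda>c. y $ c *s c"] bij_imp_bij_inv[OF assms]
    by simp
  \<comment> \<open>Pulling \<open>y\<close> back along \<open>\<tau>\<close> provides the preimage
    for the inclusion from right to left.\<close>
  have "y = permute_positions \<tau> (\<chi> c. y $ \<tau> c)" for y :: "'q ^ ('q ^ 'r)"
    using assms by (simp add: vec_eq_iff permute_positions_nth bij_is_surj surj_f_inv_f)
  then show ?thesis
    unfolding D_code_eq image_iff set_eq_iff mem_Collect_eq Bex_def by (metis sum1 sum2)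
qed

lemma distension_eq_dim_image:
  assumes "bij \<tau>"
  shows "distension \<tau> = vec.dim (weighted_sum (inv \<tau>) ` D_code)"
proof -
  \<comment> \<open>Both codes share the zero-sum condition, so only the check with weights
    \<open>inv \<tau> c\<close> is added.\<close>
  have "D_code \<inter> permute_positions \<tau> ` D_code = D_code \<inter> {y. weighted_sum (inv \<tau>) y = 0}"
    unfolding permute_positions_image_D_code[OF assms] by (auto simp: D_code_eq)
  then show ?thesis
    using dim_kernel_plus_dim_image[OF linear_weighted_sum[of "inv \<tau>"] subspace_D_code]
    by (simp add: distension_def)
qed

section \<open>Words on the product space and their marginals\<close>

definition upper_marginal ::
    "'q::{field,finite} ^ ('q ^ ('m::finite + 'n::finite)) \<Rightarrow> 'q ^ ('q ^ 'm)" where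
  "upper_marginal y = (\<chi> a. \<Sum>b\<in>UNIV. y $ stack a b)"

definition lower_marginal ::
    "'q::{field,finite} ^ ('q ^ ('m::finite + 'n::finite)) \<Rightarrow> 'q ^ ('q ^ 'n)" where
  "lower_marginal y = (\<chi> b. \<Sum>a\<in>UNIV. y $ stack a b)"

lemma sum_marginal:
  "(\<Sum>a\<in>UNIV. upper_marginal y $ a) = (\<Sum>v\<in>UNIV. y $ v)"
  "(\<Sum>b\<in>UNIV. lower_marginal y $ b) = (\<Sum>v\<in>UNIV. y $ v)"
  unfolding sum_UNIV_stack upper_marginal_def lower_marginal_def
  by (simp, simp, rule sum.swap)

text \<open>Each block of the weight depends on one block of \<open>v\<close> only, so the other
  block can be summed out first.\<close>

lemma weighted_sum_stack:
  "weighted_sum (\<lambda>v. stack (f (upper v)) (g (lower v))) y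
    = stack (weighted_sum f (upper_marginal y)) (weighted_sum g (lower_marginal y))"
proof -
  have "(\<Sum>a\<in>UNIV. \<Sum>b\<in>UNIV. y $ stack a b * g b $ j)
      = (\<Sum>b\<in>UNIV. \<Sum>a\<in>UNIV. y $ stack a b * g b $ j)" for j
    by (rule sum.swap)
  then show ?thesis
    unfolding weighted_sum_def sum_UNIV_stack
    by (simp add: vec_eq_iff stack_def[of "f _"] stack_def[of "sum _ _"] upper_marginal_def
        lower_marginal_def sum_distrib_right split: sum.split)
qed

text \<open>The identity has the stacked form with \<open>f\<close> and \<open>g\<close> identities,
  so its vanishing weighted sum splits into one check for each marginal.\<close>

lemma marginal_in_D_code:
  assumes "y \<in> D_code"
  shows "upper_marginal y \<in> D_code" and "lower_marginal y \<in> D_code"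
proof -
  have "stack (weighted_sum (\<lambda>a. a) (upper_marginal y)) (weighted_sum (\<lambda>b. b) (lower_marginal y))
      = weighted_sum (\<lambda>v. v) y"
    using weighted_sum_stack[of "\<lambda>a. a" "\<lambda>b. b" y] by simp
  also have "\<dots> = 0"
    using assms by (simp add: D_code_eq)
  also have "\<dots> = stack 0 0"
    by (simp add: stack_def vec_eq_iff split: sum.split)
  finally have "weighted_sum (\<lambda>a. a) (upper_marginal y) = 0"
    and "weighted_sum (\<lambda>b. b) (lower_marginal y) = 0"
    by (metis upper_stack, metis lower_stack)
  then show "upper_marginal y \<in> D_code" and "lower_marginal y \<in> D_code"
    using assms by (simp_all add: D_code_eq sum_marginal)
qed

text \<open>Serves as a right inverse to taking both marginals of a word. The two axes share the
  origin, where the entries of \<open>y\<close> and \<open>z\<close> are added.\<close>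

definition place_on_axes ::
    "'q::{field,finite} ^ ('q ^ 'm::finite) \<Rightarrow> 'q ^ ('q ^ 'n::finite) \<Rightarrow> 'q ^ ('q ^ ('m + 'n))" where
  "place_on_axes y z = (\<chi> v. (if lower v = 0 then y $ upper v else 0)
     + (if upper v = 0 then z $ lower v else 0))"

text \<open>The word on the other axis reaches a marginal only at position 0, and there with the sum
  of all its entries, which is zero for a codeword.\<close>

lemma marginal_place_on_axes:
  assumes "y \<in> D_code" and "z \<in> D_code"
  shows "upper_marginal (place_on_axes y z) = y" and "lower_marginal (place_on_axes y z) = z"
proof -
  have sums: "(\<Sum>a\<in>UNIV. y $ a) = 0" "(\<Sum>b\<in>UNIV. z $ b) = 0"
    using assms by (simp_all add: D_code_eq)
  have "upper_marginal (place_on_axes y z) $ a = y $ a" for a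
    by (cases "a = 0") (simp_all add: upper_marginal_def place_on_axes_def sum.distrib sums)
  moreover have "lower_marginal (place_on_axes y z) $ b = z $ b" for b
    by (cases "b = 0") (simp_all add: lower_marginal_def place_on_axes_def sum.distrib sums)
  ultimately show "upper_marginal (place_on_axes y z) = y" and "lower_marginal (place_on_axes y z) = z"
    by (auto simp: vec_eq_iff[of _ y] vec_eq_iff[of _ z])
qed

lemma place_on_axes_in_D_code:
  assumes "y \<in> D_code" and "z \<in> D_code"
  shows "place_on_axes y z \<in> D_code"
proof -
  note marginals = marginal_place_on_axes[OF assms]
  have "weighted_sum (\<lambda>v. v) (place_on_axes y z) = stack 0 0"
    using weighted_sum_stack[of "\<lambda>a. a" "\<lambda>b. b" "place_on_axes y z"] assms
    by (simp add: marginals D_code_eq)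
  also have "\<dots> = 0"
    by (simp add: stack_def vec_eq_iff split: sum.split)
  finally show ?thesis
    using assms sum_marginal(1)[of "place_on_axes y z"] by (simp add: D_code_eq marginals)
qed

text \<open>Marginals of codewords are codewords, and \<open>place_on_axes\<close> realizes any two
  codewords as the marginals of a single one, so the two components vary independently.\<close>

lemma weighted_sum_stack_image_D_code:
  "weighted_sum (\<lambda>v. stack (f (upper v)) (g (lower v))) ` D_code
    = {stack a b |a b. a \<in> weighted_sum f ` D_code \<and> b \<in> weighted_sum g ` D_code}"
proof (intro equalityI subsetI)
  fix x assume "x \<in> weighted_sum (\<lambda>v. stack (f (upper v)) (g (lower v))) ` D_code"
  then show "x \<in> {stack a b |a b. a \<in> weighted_sum f ` D_code \<and> b \<in> weighted_sum g ` D_code}"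
    unfolding weighted_sum_stack by (blast intro: marginal_in_D_code)
next
  fix x assume "x \<in> {stack a b |a b. a \<in> weighted_sum f ` D_code \<and> b \<in> weighted_sum g ` D_code}"
  then obtain y z where yz: "y \<in> D_code" "z \<in> D_code"
    and x: "x = stack (weighted_sum f y) (weighted_sum g z)"
    by blast
  show "x \<in> weighted_sum (\<lambda>v. stack (f (upper v)) (g (lower v))) ` D_code"
    using place_on_axes_in_D_code[OF yz] x
    by (intro image_eqI[of _ _ "place_on_axes y z"])
      (simp_all add: weighted_sum_stack marginal_place_on_axes[OF yz])
qed

text \<open>Brings the inverse into the stacked form for which the image of the code is known to be
  a product.\<close>

lemma inv_join_perm:
  assumes "bij \<tau>1" and "bij \<tau>2"
  shows "inv (join_perm \<tau>1 \<tau>2) = (\<lambda>v. stack (inv \<tau>1 (upper v)) (inv \<tau>2 (lower v)))"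
  by (rule inv_equality) (use assms in
      \<open>simp_all add: join_perm_def bij_is_inj bij_is_surj surj_f_inv_f\<close>)

theorem theorem4:
  fixes \<tau>1 :: "'q::{field,finite} ^ 'r1::finite \<Rightarrow> 'q ^ 'r1"
    and \<tau>2 :: "'q ^ 'r2::finite \<Rightarrow> 'q ^ 'r2"
    and l1 l2 :: nat
  assumes "bij \<tau>1" and "bij \<tau>2"
    and "distension \<tau>1 = l1" and "distension \<tau>2 = l2"
    and "\<tau>1 0 = 0" and "\<tau>2 0 = 0"
  shows "distension (join_perm \<tau>1 \<tau>2) = l1 + l2"
proof -
  have "distension (join_perm \<tau>1 \<tau>2)
      = vec.dim (weighted_sum (inv \<tau>1) ` D_code) + vec.dim (weighted_sum (inv \<tau>2) ` D_code)"
    using assms(1,2)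
    by (simp add: distension_eq_dim_image bij_join_perm inv_join_perm
        weighted_sum_stack_image_D_code dim_stack_product
        subspace_weighted_sum_image)
  then show ?thesis
    using assms(1-4) by (simp add: distension_eq_dim_image)
qed

end
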